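(* A graph $G$ is almost equimatchable (that is, $\mu(G)=1$) if and only if the following two conditions hold: (i) $G$ contains a maximal matching with an augmenting $P_4$. (ii) Every two maximal matchings of $G$ with an augmenting $P_4$ have the same size.
   Context: Graphs are finite, simple and undirected. A matching is a set of pairwise disjoint edges; it is maximal if it is not properly contained in any other matching. $\nu(G)$ is the maximum size of a matching of $G$, $\beta(G)$ is the minimum size of a maximal matching of $G$, and the matching gap of $G$ is $\mu(G)=\nu(G)-\beta(G)$. A graph is almost equimatchable if $\mu(G)=1$. A vertex is exposed by a matching $M$ if no edge of $M$ contains it. For a matching $M$, an $M$-alternating path is a path whose edges alternate between belonging to $M$ and not belonging to $M$; an $M$-augmenting path is an $M$-alternating path both of whose endpoints are exposed by $M$. A maximal matching $M$ of $G$ is "with an augmenting $P_4$" if $G$ has an $M$-augmenting path on four vertices, i.e. a path $u\,w\,y\,v$ in $G$ (as a not necessarily induced subgraph) with $wy\in M$ and $u,v$ exposed by $M$. *)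

theory Defs
  imports Main
begin

text \<open>A graph is given by its vertex set \<^term>\<open>V\<close> and its set \<^term>\<open>E\<close> of
  two-element vertex sets; loops and parallel edges are thereby excluded.\<close>

definition simple_graph :: "'a set \<Rightarrow> 'a set set \<Rightarrow> bool" where
  "simple_graph V E \<longleftrightarrow> finite V \<and> (\<forall>e\<in>E. e \<subseteq> V \<and> card e = 2)"

definition matching :: "'a set set \<Rightarrow> 'a set set \<Rightarrow> bool" where
  "matching E M \<longleftrightarrow> M \<subseteq> E \<and> pairwise disjnt M"

definition maximal_matching :: "'a set set \<Rightarrow> 'a set set \<Rightarrow> bool" where
  "maximal_matching E M \<longleftrightarrow> matching E M \<and> \<not> (\<exists>M'. matching E M' \<and> M \<subset> M')"

definition max_matching_size :: "'a set set \<Rightarrow> nat" where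
  "max_matching_size E = Max {card M | M. matching E M}"

definition min_maximal_matching_size :: "'a set set \<Rightarrow> nat" where
  "min_maximal_matching_size E = Min {card M | M. maximal_matching E M}"

definition matching_gap :: "'a set set \<Rightarrow> int" where
  "matching_gap E = int (max_matching_size E) - int (min_maximal_matching_size E)"

definition almost_equimatchable :: "'a set set \<Rightarrow> bool" where
  "almost_equimatchable E \<longleftrightarrow> matching_gap E = 1"

definition exposed :: "'a set set \<Rightarrow> 'a \<Rightarrow> bool" where
  "exposed M v \<longleftrightarrow> (\<forall>e\<in>M. v \<notin> e)"

text \<open>Paths are represented by their vertex sequences and need not be induced.\<close>

definition graph_path :: "'a set \<Rightarrow> 'a set set \<Rightarrow> 'a list \<Rightarrow> bool" where
  "graph_path V E p \<longleftrightarrow> p \<noteq> [] \<and> distinct p \<and> set p \<subseteq> V \<and>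
     (\<forall>i. Suc i < length p \<longrightarrow> {p ! i, p ! Suc i} \<in> E)"

definition alternating_path :: "'a set \<Rightarrow> 'a set set \<Rightarrow> 'a set set \<Rightarrow> 'a list \<Rightarrow> bool" where
  "alternating_path V E M p \<longleftrightarrow> graph_path V E p \<and>
     (\<forall>i. Suc (Suc i) < length p \<longrightarrow>
        ({p ! i, p ! Suc i} \<in> M \<longleftrightarrow> {p ! Suc i, p ! Suc (Suc i)} \<notin> M))"

text \<open>The length bound excludes the one-vertex path, whose endpoints coincide.\<close>

definition augmenting_path :: "'a set \<Rightarrow> 'a set set \<Rightarrow> 'a set set \<Rightarrow> 'a list \<Rightarrow> bool" where
  "augmenting_path V E M p \<longleftrightarrow> alternating_path V E M p \<and> 2 \<le> length p \<and>
     exposed M (hd p) \<and> exposed M (last p)"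

definition has_augmenting_P4 :: "'a set \<Rightarrow> 'a set set \<Rightarrow> 'a set set \<Rightarrow> bool" where
  "has_augmenting_P4 V E M \<longleftrightarrow> (\<exists>p. augmenting_path V E M p \<and> length p = 4)"

lemma has_augmenting_P4_iff:
  assumes "simple_graph V E"
  shows "has_augmenting_P4 V E M \<longleftrightarrow>
    (\<exists>u w y v. distinct [u, w, y, v] \<and> {u, w} \<in> E \<and> {w, y} \<in> E \<and> {y, v} \<in> E \<and>
       {w, y} \<in> M \<and> exposed M u \<and> exposed M v)"
    (is "_ \<longleftrightarrow> (\<exists>u w y v. ?P u w y v)")
proof -
  have aug: "augmenting_path V E M [u, w, y, v] \<longleftrightarrow> ?P u w y v" for u w y v
  proof -
    have all3: "(\<forall>i. Suc i < length [u, w, y, v] \<longrightarrow> Q i) \<longleftrightarrow> Q 0 \<and> Q 1 \<and> Q 2" for Q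
      by (auto simp: less_Suc_eq numeral_eq_Suc)
    have all2: "(\<forall>i. Suc (Suc i) < length [u, w, y, v] \<longrightarrow> Q i) \<longleftrightarrow> Q 0 \<and> Q 1" for Q
      by (auto simp: less_Suc_eq numeral_eq_Suc)
    have inV: "{a, b} \<in> E \<Longrightarrow> a \<in> V \<and> b \<in> V" for a b
      using assms unfolding simple_graph_def by blast
    have "exposed M u \<Longrightarrow> {u, w} \<notin> M" "exposed M v \<Longrightarrow> {y, v} \<notin> M"
      unfolding exposed_def by blast+
    then show ?thesis
      unfolding augmenting_path_def alternating_path_def graph_path_def all3 all2
      using inV by auto
  qed
  have "has_augmenting_P4 V E M \<longleftrightarrow> (\<exists>u w y v. augmenting_path V E M [u, w, y, v])"
  proof
    assume "has_augmenting_P4 V E M"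
    then obtain p where p: "augmenting_path V E M p" "length p = 4"
      unfolding has_augmenting_P4_def by blast
    from p(2) obtain u w y v where "p = [u, w, y, v]"
      by (auto simp: numeral_eq_Suc length_Suc_conv)
    with p(1) show "\<exists>u w y v. augmenting_path V E M [u, w, y, v]" by blast
  next
    assume "\<exists>u w y v. augmenting_path V E M [u, w, y, v]"
    then obtain u w y v where "augmenting_path V E M [u, w, y, v]" by blast
    then show "has_augmenting_P4 V E M"
      unfolding has_augmenting_P4_def by (intro exI[of _ "[u, w, y, v]"]) simp
  qed
  then show ?thesis by (simp only: aug)
qed

end

theory Submission
  imports Defs
begin

text \<open>
  Write \<open>\<nu>\<close> and \<open>\<beta>\<close> for the largest and the smallest size of a maximal matching. Two facts
  relate augmenting \<open>P\<^sub>4\<close>s to these sizes.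

  Augmenting a maximal matching along a \<open>P\<^sub>4\<close> yields a matching with one edge more that covers
  all the vertices covered before, hence again a maximal matching
  (\<open>maximal_matching_augment_P4\<close>). So only sizes below \<open>\<nu>\<close> admit an augmenting \<open>P\<^sub>4\<close>.

  Conversely, every size below \<open>\<nu>\<close> that is attained by a maximal matching \<open>M\<close> is attained by one
  with an augmenting \<open>P\<^sub>4\<close> (\<open>exists_augmenting_P4_same_size\<close>). To see this, compare \<open>M\<close> with a
  larger matching \<open>N\<close>. Some edge \<open>{u, w}\<close> of \<open>N\<close> has an end \<open>u\<close> exposed by \<open>M\<close>, and \<open>w\<close> lies on
  an edge \<open>{w, y}\<close> of \<open>M\<close> because \<open>M\<close> is maximal. Replace \<open>{w, y}\<close> by \<open>{u, w}\<close> in \<open>M\<close>. The only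
  newly exposed vertex is \<open>y\<close>; if the result is not maximal, then \<open>y\<close> is adjacent to another
  exposed vertex \<open>v\<close>, and \<open>u w y v\<close> is an augmenting \<open>P\<^sub>4\<close> for \<open>M\<close> itself. Otherwise the result
  is a maximal matching of the same size that shares one more edge with \<open>N\<close>, so the exchange
  cannot go on forever. This takes the place of following an augmenting path to its end.

  Together, the sizes of the maximal matchings with an augmenting \<open>P\<^sub>4\<close> are exactly those sizes
  of maximal matchings that lie below \<open>\<nu>\<close>. If \<open>\<nu> > \<beta>\<close>, then \<open>\<beta>\<close> is among them, and one
  augmentation shows that \<open>\<beta> + 1\<close> is among them too unless \<open>\<nu> = \<beta> + 1\<close>. Hence there is exactly
  one such size if and only if \<open>\<nu> = \<beta> + 1\<close>.
\<close>

lemma finite_edges: "simple_graph V E \<Longrightarrow> finite E"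
  unfolding simple_graph_def by (rule finite_subset[of _ "Pow V"]) auto

lemma finite_matching: "simple_graph V E \<Longrightarrow> matching E M \<Longrightarrow> finite M"
  using finite_edges finite_subset unfolding matching_def by blast

lemma card_edge: "simple_graph V E \<Longrightarrow> e \<in> E \<Longrightarrow> card e = 2"
  unfolding simple_graph_def by blast

lemma edge_obtain_other_end:
  assumes "simple_graph V E" "e \<in> E" "x \<in> e"
  obtains y where "e = {x, y}" "x \<noteq> y"
  using card_edge[OF assms(1,2)] assms(3) unfolding card_2_iff by blast

lemma exposed_iff: "exposed M v \<longleftrightarrow> v \<notin> \<Union>M"
  unfolding exposed_def by blast

lemma matching_subset: "matching E M \<Longrightarrow> M' \<subseteq> M \<Longrightarrow> matching E M'"
  unfolding matching_def by (meson order_trans pairwise_subset)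

lemma matching_insert:
  "matching E M \<Longrightarrow> e \<in> E \<Longrightarrow> e \<inter> \<Union>M = {} \<Longrightarrow> matching E (insert e M)"
  unfolding matching_def pairwise_insert disjnt_def by blast

lemma matching_unique_edge:
  "matching E M \<Longrightarrow> e \<in> M \<Longrightarrow> f \<in> M \<Longrightarrow> x \<in> e \<Longrightarrow> x \<in> f \<Longrightarrow> e = f"
  unfolding matching_def pairwise_def disjnt_def by blast

lemma matching_Union_remove:
  assumes "matching E M" "f \<in> M"
  shows "\<Union>(M - {f}) = \<Union>M - f"
  using matching_unique_edge[OF assms(1) _ assms(2)] assms(2) by blast

lemma card_Union_matching:
  assumes "simple_graph V E" "matching E M"
  shows "card (\<Union>M) = 2 * card M"
proof -
  have c: "card e = 2" if "e \<in> M" for e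
    using assms that card_edge unfolding matching_def by blast
  have "card (\<Union>M) = sum card M"
  proof (rule card_Union_disjoint)
    show "pairwise disjnt M" using assms(2) unfolding matching_def by (rule conjunct2)
    show "finite e" if "e \<in> M" for e using c[OF that] by (intro card_ge_0_finite) simp
  qed
  then show ?thesis using c by simp
qed

text \<open>
  In this form maximality depends only on the set of covered vertices, which is what the
  exchange and augmentation arguments keep track of.
\<close>

lemma maximal_matching_iff_covers:
  assumes "simple_graph V E"
  shows "maximal_matching E M \<longleftrightarrow> matching E M \<and> (\<forall>e\<in>E. e \<inter> \<Union>M \<noteq> {})"
proof
  assume M: "maximal_matching E M"
  have "e \<inter> \<Union>M \<noteq> {}" if e: "e \<in> E" for e
  proof
    assume disj: "e \<inter> \<Union>M = {}"
    have "e \<noteq> {}" using card_edge[OF assms e] by auto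
    then have "M \<subset> insert e M" using disj by blast
    with M matching_insert[OF _ e disj] show False unfolding maximal_matching_def by blast
  qed
  with M show "matching E M \<and> (\<forall>e\<in>E. e \<inter> \<Union>M \<noteq> {})" unfolding maximal_matching_def by blast
next
  assume R: "matching E M \<and> (\<forall>e\<in>E. e \<inter> \<Union>M \<noteq> {})"
  have False if M': "matching E M'" "M \<subset> M'" for M'
  proof -
    obtain e where e: "e \<in> M'" "e \<notin> M" using M'(2) by blast
    then have "e \<in> E" using M'(1) unfolding matching_def by blast
    then obtain x f where "x \<in> e" "f \<in> M" "x \<in> f" using R by blast
    with e M' matching_unique_edge[OF M'(1)] show False by blast
  qed
  with R show "maximal_matching E M" unfolding maximal_matching_def by blast
qed

text \<open>
  With \<open>u w y v\<close> the augmenting path, \<open>{w, y}\<close> is traded for \<open>{u, w}\<close> and \<open>{y, v}\<close>. No covered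
  vertex becomes exposed, so maximality survives.
\<close>

lemma maximal_matching_augment_P4:
  assumes G: "simple_graph V E" and M: "maximal_matching E M" and P: "has_augmenting_P4 V E M"
  shows "\<exists>M'. maximal_matching E M' \<and> card M' = Suc (card M)"
proof -
  have mM: "matching E M" using M unfolding maximal_matching_def by blast
  obtain u w y v where d: "distinct [u, w, y, v]"
    and E: "{u, w} \<in> E" "{y, v} \<in> E" and wy: "{w, y} \<in> M"
    and ex: "u \<notin> \<Union>M" "v \<notin> \<Union>M"
    using P unfolding has_augmenting_P4_iff[OF G] exposed_iff by blast
  define R where "R = M - {{w, y}}"
  have mR: "matching E R" using matching_subset[OF mM] unfolding R_def by blast
  have UR: "\<Union>R = \<Union>M - {w, y}" unfolding R_def by (rule matching_Union_remove[OF mM wy])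
  have m1: "matching E (insert {y, v} R)"
    using matching_insert[OF mR E(2)] UR ex d by auto
  have m2: "matching E (insert {u, w} (insert {y, v} R))" (is "matching E ?M'")
    using matching_insert[OF m1 E(1)] UR ex d by auto
  have "{y, v} \<notin> R" "{u, w} \<notin> insert {y, v} R"
    using UR d by (auto simp: doubleton_eq_iff)
  then have "card ?M' = Suc (card M)"
    using finite_matching[OF G mM] card_Suc_Diff1[OF finite_matching[OF G mM] wy]
    unfolding R_def by simp
  moreover have "maximal_matching E ?M'"
  proof -
    have "\<Union>M \<subseteq> \<Union>?M'" using UR by auto
    moreover have "\<forall>e\<in>E. e \<inter> \<Union>M \<noteq> {}"
      using M unfolding maximal_matching_iff_covers[OF G] by (rule conjunct2)
    ultimately have "\<forall>e\<in>E. e \<inter> \<Union>?M' \<noteq> {}"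
      by (metis Int_mono order_refl subset_empty)
    with m2 show ?thesis unfolding maximal_matching_iff_covers[OF G] by (rule conjI)
  qed
  ultimately show ?thesis by (intro exI[of _ ?M'] conjI)
qed

text \<open>
  One step of the comparison with a larger matching: either \<open>M\<close> already has an augmenting
  \<open>P\<^sub>4\<close>, or it can be moved one edge closer to \<open>N\<close> without changing its size.
\<close>

lemma augmenting_P4_or_exchange:
  assumes G: "simple_graph V E" and M: "maximal_matching E M"
    and N: "matching E N" and less: "card M < card N"
  shows "has_augmenting_P4 V E M \<or>
    (\<exists>M'. maximal_matching E M' \<and> card M' = card M \<and> card (N - M') < card (N - M))"
proof (rule disjCI)
  assume no_exchange:
    "\<not> (\<exists>M'. maximal_matching E M' \<and> card M' = card M \<and> card (N - M') < card (N - M))"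
  have mM: "matching E M" using M unfolding maximal_matching_def by blast
  have cov: "\<And>e. e \<in> E \<Longrightarrow> e \<inter> \<Union>M \<noteq> {}"
    using M unfolding maximal_matching_iff_covers[OF G] by blast
  have ME: "M \<subseteq> E" and NE: "N \<subseteq> E" using mM N unfolding matching_def by auto
  have finM: "finite M" and finN: "finite N" using finite_matching[OF G] mM N by auto
  \<comment> \<open>The larger matching covers more vertices, so one of them is exposed by the smaller one.\<close>
  have "card (\<Union>M) < card (\<Union>N)"
    using less card_Union_matching[OF G] mM N by simp
  moreover have "finite (\<Union>M)"
  proof (rule finite_subset)
    show "finite V" using G unfolding simple_graph_def by (rule conjunct1)
    show "\<Union>M \<subseteq> V" using G ME unfolding simple_graph_def by (meson Sup_least subsetD)
  qed
  ultimately have "\<not> \<Union>N \<subseteq> \<Union>M" using card_mono leD by blast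
  then obtain u e where u: "u \<notin> \<Union>M" "u \<in> e" "e \<in> N" by blast
  have eE: "e \<in> E" using u(3) NE by blast
  obtain w where e: "e = {u, w}" and uw: "u \<noteq> w"
    using edge_obtain_other_end[OF G eE u(2)] .
  have "w \<in> \<Union>M" using cov[OF eE] u(1) e by blast
  then obtain f where f: "f \<in> M" "w \<in> f" by blast
  have fE: "f \<in> E" using f(1) ME by blast
  obtain y where fy: "f = {w, y}" and wy: "w \<noteq> y"
    using edge_obtain_other_end[OF G fE f(2)] .
  have uy: "u \<noteq> y" using u(1) f(1) fy by blast
  define M' where "M' = insert e (M - {f})"
  have UR: "\<Union>(M - {f}) = \<Union>M - f" by (rule matching_Union_remove[OF mM f(1)])
  have mM': "matching E M'" unfolding M'_def
    using matching_insert[OF matching_subset[OF mM] eE, of "M - {f}"] UR u(1) e fy by auto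
  have UM': "\<Union>M' = insert u (\<Union>M - {y})"
    using UR u(1) e fy f(1) wy uy unfolding M'_def by auto
  have "e \<notin> M" using u by blast
  then have card': "card M' = card M"
    using finM card_Suc_Diff1[OF finM f(1)] unfolding M'_def by simp
  have "f \<notin> N"
    using matching_unique_edge[OF N u(3) _ _ f(2)] e u(1) f(1) by blast
  \<comment> \<open>So the exchange gains the edge \<open>e\<close> of \<open>N\<close> without giving one up.\<close>
  then have "N - M' \<subset> N - M" using u(3) \<open>e \<notin> M\<close> unfolding M'_def by blast
  then have "card (N - M') < card (N - M)" using finN by (simp add: psubset_card_mono)
  with no_exchange card' have "\<not> maximal_matching E M'" by blast
  then obtain g where g: "g \<in> E" "g \<inter> \<Union>M' = {}"
    using mM' unfolding maximal_matching_iff_covers[OF G] by blast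
  \<comment> \<open>Only \<open>y\<close> lost its cover, so it is to blame for the uncovered edge \<open>g\<close>.\<close>
  have "y \<in> g" using cov[OF g(1)] g(2) UM' by blast
  then obtain v where gv: "g = {y, v}" and yv: "y \<noteq> v"
    using edge_obtain_other_end[OF G g(1)] by blast
  have v: "v \<noteq> u" "v \<notin> \<Union>M" using g(2) gv UM' yv by auto
  have "v \<noteq> w" using v(2) f by blast
  then have "distinct [u, w, y, v]" using v(1) uw wy uy yv by auto
  moreover have "{u, w} \<in> E" "{w, y} \<in> E" "{y, v} \<in> E" "{w, y} \<in> M"
    using eE fE g(1) f(1) unfolding e fy gv by this+
  ultimately show "has_augmenting_P4 V E M"
    using u(1) v(2) unfolding has_augmenting_P4_iff[OF G] exposed_iff by blast
qed

lemma exists_augmenting_P4_same_size: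
  assumes G: "simple_graph V E" and "maximal_matching E M"
    and N: "matching E N" and "card M < card N"
  shows "\<exists>M'. maximal_matching E M' \<and> has_augmenting_P4 V E M' \<and> card M' = card M"
  using assms(2,4)
proof (induction "card (N - M)" arbitrary: M rule: less_induct)
  case less
  from augmenting_P4_or_exchange[OF G less.prems(1) N less.prems(2)] less show ?case
    by metis
qed

lemma max_matching_size:
  assumes G: "simple_graph V E"
  shows "\<exists>N. matching E N \<and> card N = max_matching_size E"
    and "matching E M \<Longrightarrow> card M \<le> max_matching_size E"
proof -
  let ?S = "{card M | M. matching E M}"
  have "?S \<subseteq> card ` Pow E" unfolding matching_def by blast
  then have fin: "finite ?S" using finite_edges[OF G] finite_subset by blast
  have "matching E {}" unfolding matching_def by simp
  then have "Max ?S \<in> ?S" using fin by (intro Max_in) blast+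
  then show "\<exists>N. matching E N \<and> card N = max_matching_size E"
    unfolding max_matching_size_def by auto
  show "matching E M \<Longrightarrow> card M \<le> max_matching_size E"
    unfolding max_matching_size_def using fin by (intro Max_ge) blast+
qed

lemma exists_maximal_matching:
  assumes G: "simple_graph V E"
  shows "\<exists>M. maximal_matching E M"
proof -
  obtain N where N: "matching E N" "card N = max_matching_size E"
    using max_matching_size(1)[OF G] by blast
  have "\<not> N \<subset> M'" if "matching E M'" for M'
    using max_matching_size(2)[OF G that] N(2)
      psubset_card_mono[OF finite_matching[OF G that], of N] by linarith
  with N(1) show ?thesis unfolding maximal_matching_def by blast
qed

lemma min_maximal_matching_size:
  assumes G: "simple_graph V E"
  shows "\<exists>B. maximal_matching E B \<and> card B = min_maximal_matching_size E"
    and "maximal_matching E M \<Longrightarrow> min_maximal_matching_size E \<le> card M"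
proof -
  let ?S = "{card M | M. maximal_matching E M}"
  have "?S \<subseteq> card ` Pow E" unfolding maximal_matching_def matching_def by blast
  then have fin: "finite ?S" using finite_edges[OF G] finite_subset by blast
  have "Min ?S \<in> ?S" using fin exists_maximal_matching[OF G] by (intro Min_in) blast+
  then show "\<exists>B. maximal_matching E B \<and> card B = min_maximal_matching_size E"
    unfolding min_maximal_matching_size_def by auto
  show "maximal_matching E M \<Longrightarrow> min_maximal_matching_size E \<le> card M"
    unfolding min_maximal_matching_size_def using fin by (intro Min_le) blast+
qed

theorem theorem2p6:
  fixes V :: "'a set" and E :: "'a set set"
  assumes "simple_graph V E"
  shows "almost_equimatchable E \<longleftrightarrow>
    (\<exists>M. maximal_matching E M \<and> has_augmenting_P4 V E M) \<and>
    (\<forall>M N. maximal_matching E M \<and> has_augmenting_P4 V E M \<and>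
           maximal_matching E N \<and> has_augmenting_P4 V E N \<longrightarrow> card M = card N)"
proof -
  let ?\<nu> = "max_matching_size E" and ?\<beta> = "min_maximal_matching_size E"
  let ?P = "\<lambda>M. maximal_matching E M \<and> has_augmenting_P4 V E M"
  have gap: "almost_equimatchable E \<longleftrightarrow> ?\<nu> = Suc ?\<beta>"
    unfolding almost_equimatchable_def matching_gap_def by auto
  obtain N where N: "matching E N" "card N = ?\<nu>" using max_matching_size(1)[OF assms] by blast
  obtain B where B: "maximal_matching E B" "card B = ?\<beta>"
    using min_maximal_matching_size(1)[OF assms] by blast
  have below: "card M < ?\<nu>" if "?P M" for M
    using maximal_matching_augment_P4[OF assms] that max_matching_size(2)[OF assms]
    unfolding maximal_matching_def by (metis Suc_le_eq)
  have same_size: "\<exists>M'. ?P M' \<and> card M' = card M" if "maximal_matching E M" "card M < ?\<nu>" for M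
    using exists_augmenting_P4_same_size[OF assms that(1) N(1)] that(2) N(2) by auto
  show ?thesis unfolding gap
  proof (intro iffI)
    assume eq: "?\<nu> = Suc ?\<beta>"
    have "card M = ?\<beta>" if "?P M" for M
      using below[OF that] min_maximal_matching_size(2)[OF assms] that eq
      by (metis le_antisym less_Suc_eq_le)
    moreover have "\<exists>M. ?P M" using same_size[OF B(1)] B(2) eq by auto
    ultimately show "(\<exists>M. ?P M) \<and> (\<forall>M N. maximal_matching E M \<and> has_augmenting_P4 V E M \<and>
           maximal_matching E N \<and> has_augmenting_P4 V E N \<longrightarrow> card M = card N)"
      by metis
  next
    assume R: "(\<exists>M. ?P M) \<and> (\<forall>M N. maximal_matching E M \<and> has_augmenting_P4 V E M \<and>
           maximal_matching E N \<and> has_augmenting_P4 V E N \<longrightarrow> card M = card N)"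
    have lt: "?\<beta> < ?\<nu>"
      using R below min_maximal_matching_size(2)[OF assms] by (meson le_less_trans)
    then obtain B' where B': "?P B'" "card B' = ?\<beta>" using same_size[OF B(1)] B(2) by auto
    obtain C where C: "maximal_matching E C" "card C = Suc ?\<beta>"
      using maximal_matching_augment_P4[OF assms] B' by metis
    have "\<not> card C < ?\<nu>"
    proof
      assume "card C < ?\<nu>"
      then obtain C' where "?P C'" "card C' = Suc ?\<beta>" using same_size[OF C(1)] C(2) by auto
      with R B' show False by (metis n_not_Suc_n)
    qed
    with lt C(2) show "?\<nu> = Suc ?\<beta>" by simp
  qed
qed

end
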